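(* Let $(L;\wedge,\vee,^{\Delta},^{\nabla},0,1)$ be a weakly dicomplemented lattice, $E$ a filter of $\overline{S}(L)$ and $F$ a filter of $L$. (1) $E$ is a primary filter of $\overline{S}(L)$ if and only if $E$ is a prime filter of $\overline{S}(L)$. (2) If $E$ is a primary filter of $\overline{S}(L)$, then $E$ is a maximal filter of $\overline{S}(L)$, i.e. there is no filter $H$ of $\overline{S}(L)$ with $E\subsetneq H\subsetneq\overline{S}(L)$. (3) If $F$ is a maximal filter of $L$ (a proper filter not strictly contained in any proper filter of $L$), then $F$ is a primary filter of $L$. The converse does not hold: there exist a weakly dicomplemented lattice and a primary filter of it that is not a maximal filter.
   Context: A weakly dicomplemented lattice (WDL) is an algebra $(L;\wedge,\vee,^{\Delta},^{\nabla},0,1)$ such that $(L;\wedge,\vee,0,1)$ is a bounded lattice and, for all $x,y\in L$: $x^{\Delta\Delta}\le x$; $x\le y\Rightarrow y^{\Delta}\le x^{\Delta}$; $(x\wedge y)\vee(x\wedge y^{\Delta})=x$; $x^{\nabla\nabla}\ge x$; $x\le y\Rightarrow y^{\nabla}\le x^{\nabla}$; $(x\vee y)\wedge(x\vee y^{\nabla})=x$. A filter of $L$ is a nonempty upward closed subset closed under $\wedge$; it is primary if for every $x\in L$, $x\in F$ or $x^{\Delta}\in F$. $\overline{S}(L)=\{x\in L\mid x^{\Delta\Delta}=x\}$, $x\,\overline{\sqcap}\,y=(x^{\Delta}\vee y^{\Delta})^{\Delta}$; $(\overline{S}(L);\overline{\sqcap},\vee,^{\Delta},0,1)$ is an ortholattice.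 A filter of $\overline{S}(L)$ is a nonempty subset of $\overline{S}(L)$ upward closed within $\overline{S}(L)$ and closed under $\overline{\sqcap}$; it is primary if for every $x\in\overline{S}(L)$, $x\in E$ or $x^{\Delta}\in E$, and prime if for $x,y\in\overline{S}(L)$, $x\vee y\in E$ implies $x\in E$ or $y\in E$. *)

theory Defs
  imports "HOL-Algebra.Lattice"
begin

record 'a wdl = "'a gorder" +
  delta :: "'a \<Rightarrow> 'a" (\<open>\<Delta>\<index> _\<close> [91] 90)
  nabla :: "'a \<Rightarrow> 'a" (\<open>\<nabla>\<index> _\<close> [91] 90)

locale weakly_dicomplemented_lattice = bounded_lattice L for L (structure) +
  assumes delta_closed: "x \<in> carrier L \<Longrightarrow> \<Delta> x \<in> carrier L"
    and nabla_closed: "x \<in> carrier L \<Longrightarrow> \<nabla> x \<in> carrier L"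
    and delta_delta_le: "x \<in> carrier L \<Longrightarrow> \<Delta> (\<Delta> x) \<sqsubseteq> x"
    and delta_antitone:
      "\<lbrakk>x \<in> carrier L; y \<in> carrier L; x \<sqsubseteq> y\<rbrakk> \<Longrightarrow> \<Delta> y \<sqsubseteq> \<Delta> x"
    and delta_decomp:
      "\<lbrakk>x \<in> carrier L; y \<in> carrier L\<rbrakk> \<Longrightarrow> (x \<sqinter> y) \<squnion> (x \<sqinter> (\<Delta> y)) = x"
    and nabla_nabla_ge: "x \<in> carrier L \<Longrightarrow> x \<sqsubseteq> \<nabla> (\<nabla> x)"
    and nabla_antitone:
      "\<lbrakk>x \<in> carrier L; y \<in> carrier L; x \<sqsubseteq> y\<rbrakk> \<Longrightarrow> \<nabla> y \<sqsubseteq> \<nabla> x"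
    and nabla_decomp:
      "\<lbrakk>x \<in> carrier L; y \<in> carrier L\<rbrakk> \<Longrightarrow> (x \<squnion> y) \<sqinter> (x \<squnion> (\<nabla> y)) = x"

text \<open>Filters, primary filters and prime filters are not required to be proper;
  only \<open>is_maximal_filter\<close> includes properness.\<close>

definition is_lattice_filter :: "('a, 'b) wdl_scheme \<Rightarrow> 'a set \<Rightarrow> bool" where
  "is_lattice_filter L F \<longleftrightarrow>
     F \<subseteq> carrier L \<and> F \<noteq> {} \<and>
     (\<forall>x\<in>F. \<forall>y\<in>carrier L. x \<sqsubseteq>\<^bsub>L\<^esub> y \<longrightarrow> y \<in> F) \<and>
     (\<forall>x\<in>F. \<forall>y\<in>F. x \<sqinter>\<^bsub>L\<^esub> y \<in> F)"

definition is_primary_filter :: "('a, 'b) wdl_scheme \<Rightarrow> 'a set \<Rightarrow> bool" where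
  "is_primary_filter L F \<longleftrightarrow>
     is_lattice_filter L F \<and> (\<forall>x\<in>carrier L. x \<in> F \<or> \<Delta>\<^bsub>L\<^esub> x \<in> F)"

definition is_maximal_filter :: "('a, 'b) wdl_scheme \<Rightarrow> 'a set \<Rightarrow> bool" where
  "is_maximal_filter L F \<longleftrightarrow>
     is_lattice_filter L F \<and> F \<noteq> carrier L \<and>
     \<not> (\<exists>H. is_lattice_filter L H \<and> H \<noteq> carrier L \<and> F \<subset> H)"

definition skeleton :: "('a, 'b) wdl_scheme \<Rightarrow> 'a set" where
  "skeleton L = {x \<in> carrier L. \<Delta>\<^bsub>L\<^esub> (\<Delta>\<^bsub>L\<^esub> x) = x}"

definition skeleton_meet :: "('a, 'b) wdl_scheme \<Rightarrow> 'a \<Rightarrow> 'a \<Rightarrow> 'a" where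
  "skeleton_meet L x y = \<Delta>\<^bsub>L\<^esub> ((\<Delta>\<^bsub>L\<^esub> x) \<squnion>\<^bsub>L\<^esub> (\<Delta>\<^bsub>L\<^esub> y))"

definition is_skeleton_filter :: "('a, 'b) wdl_scheme \<Rightarrow> 'a set \<Rightarrow> bool" where
  "is_skeleton_filter L E \<longleftrightarrow>
     E \<subseteq> skeleton L \<and> E \<noteq> {} \<and>
     (\<forall>x\<in>E. \<forall>y\<in>skeleton L. x \<sqsubseteq>\<^bsub>L\<^esub> y \<longrightarrow> y \<in> E) \<and>
     (\<forall>x\<in>E. \<forall>y\<in>E. skeleton_meet L x y \<in> E)"

definition is_primary_skeleton_filter :: "('a, 'b) wdl_scheme \<Rightarrow> 'a set \<Rightarrow> bool" where
  "is_primary_skeleton_filter L E \<longleftrightarrow>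
     is_skeleton_filter L E \<and> (\<forall>x\<in>skeleton L. x \<in> E \<or> \<Delta>\<^bsub>L\<^esub> x \<in> E)"

definition is_prime_skeleton_filter :: "('a, 'b) wdl_scheme \<Rightarrow> 'a set \<Rightarrow> bool" where
  "is_prime_skeleton_filter L E \<longleftrightarrow>
     is_skeleton_filter L E \<and>
     (\<forall>x\<in>skeleton L. \<forall>y\<in>skeleton L. x \<squnion>\<^bsub>L\<^esub> y \<in> E \<longrightarrow> x \<in> E \<or> y \<in> E)"

definition is_maximal_skeleton_filter :: "('a, 'b) wdl_scheme \<Rightarrow> 'a set \<Rightarrow> bool" where
  "is_maximal_skeleton_filter L E \<longleftrightarrow>
     is_skeleton_filter L E \<and>
     \<not> (\<exists>H. is_skeleton_filter L H \<and> E \<subset> H \<and> H \<subset> skeleton L)"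

end

theory Submission
  imports Defs
begin

text \<open>
  In the skeleton, an element and its \<open>\<Delta>\<close>-complement meet in \<open>\<bottom>\<close> and join to \<open>\<top>\<close>, so the
  classical arguments for ultrafilters of Boolean algebras apply. For a maximal filter \<open>F\<close> of \<open>L\<close>
  and \<open>x \<notin> F\<close>, maximality yields \<open>f \<in> F\<close> with \<open>f \<sqinter> x = \<bottom>\<close>; then
  \<open>f = (f \<sqinter> x) \<squnion> (f \<sqinter> \<Delta> x) = f \<sqinter> \<Delta> x\<close>, whence \<open>\<Delta> x \<in> F\<close>. The converse fails on the chain with
  three elements, where \<open>\<Delta> x = \<top>\<close> for \<open>x \<noteq> \<top>\<close>: the filter \<open>{\<top>}\<close> is primary but not maximal.
\<close>

context weakly_dicomplemented_lattice
begin

text \<open>Decomposing \<open>\<top>\<close> along \<open>x\<close> turns both meets in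
  \<open>delta_decomp\<close> into \<open>x\<close> and \<open>\<Delta> x\<close>.\<close>

lemma join_delta:
  assumes "x \<in> carrier L"
  shows "x \<squnion> \<Delta> x = \<top>"
  using delta_decomp[of \<top> x] top_meet[of x] top_meet[of "\<Delta> x"] assms
  by (simp add: eq_is_equal delta_closed)

lemma delta_bottom: "\<Delta> \<bottom> = \<top>"
  using join_delta[of \<bottom>] bottom_join[of "\<Delta> \<bottom>"] by (simp add: eq_is_equal delta_closed)

lemma delta_top: "\<Delta> \<top> = \<bottom>"
proof -
  have "\<Delta> (\<Delta> \<bottom>) \<sqsubseteq> \<bottom>"
    by (simp add: delta_delta_le)
  then show ?thesis
    using delta_bottom bottom_lower[of "\<Delta> \<top>"] delta_closed[of \<top>] le_antisym by simp
qed

lemma bottom_in_skeleton: "\<bottom> \<in> skeleton L"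
  and top_in_skeleton: "\<top> \<in> skeleton L"
  by (simp_all add: skeleton_def delta_bottom delta_top)

text \<open>One inequality is \<open>delta_delta_le\<close> at \<open>\<Delta> x\<close>; the other
  applies antitonicity to \<open>\<Delta> (\<Delta> x) \<sqsubseteq> x\<close>.\<close>

lemma delta_in_skeleton: "x \<in> carrier L \<Longrightarrow> \<Delta> x \<in> skeleton L"
  by (auto simp: skeleton_def delta_closed intro!: le_antisym delta_delta_le delta_antitone)

lemma skeleton_meet_delta:
  assumes "x \<in> skeleton L"
  shows "skeleton_meet L x (\<Delta> x) = \<bottom>"
  using assms join_delta[of "\<Delta> x"]
  by (auto simp: skeleton_meet_def skeleton_def delta_closed delta_top)

lemma skeleton_filter_top:
  assumes "is_skeleton_filter L E"
  shows "\<top> \<in> E"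
proof -
  obtain x where "x \<in> E" "x \<in> carrier L"
    using assms unfolding is_skeleton_filter_def skeleton_def by blast
  then show ?thesis
    using assms top_in_skeleton top_higher by (auto simp: is_skeleton_filter_def)
qed

text \<open>The skeleton meet of \<open>x\<close> and \<open>\<Delta> x\<close> is
  \<open>\<bottom>\<close>, and upward closure from \<open>\<bottom>\<close> gives everything. This
  is the source of contradiction for the skeleton results below.\<close>

lemma skeleton_filter_improper:
  assumes E: "is_skeleton_filter L E" and x: "x \<in> E" "\<Delta> x \<in> E"
  shows "E = skeleton L"
proof -
  have "x \<in> skeleton L"
    using E x by (auto simp: is_skeleton_filter_def)
  then have "\<bottom> \<in> E"
    using E x skeleton_meet_delta[of x] by (metis is_skeleton_filter_def)
  then show ?thesis
    using E bottom_lower by (auto simp: is_skeleton_filter_def skeleton_def)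
qed

lemma primary_iff_prime_skeleton_filter:
  "is_primary_skeleton_filter L E \<longleftrightarrow> is_prime_skeleton_filter L E"
proof
  assume P: "is_primary_skeleton_filter L E"
  then have E: "is_skeleton_filter L E"
    by (simp add: is_primary_skeleton_filter_def)
  have "x \<in> E \<or> y \<in> E" if x: "x \<in> skeleton L" and y: "y \<in> skeleton L" and xy: "x \<squnion> y \<in> E" for x y
  proof (rule ccontr)
    assume n: "\<not> (x \<in> E \<or> y \<in> E)"
    then have "\<Delta> x \<in> E" "\<Delta> y \<in> E"
      using P x y by (auto simp: is_primary_skeleton_filter_def)
    then have "skeleton_meet L (\<Delta> x) (\<Delta> y) \<in> E"
      using E by (simp add: is_skeleton_filter_def)
    \<comment> \<open>On the skeleton the double \<open>\<Delta>\<close> cancels, so this meet is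
      literally the complement of \<open>x \<squnion> y\<close>.\<close>
    then have "\<Delta> (x \<squnion> y) \<in> E"
      using x y by (simp add: skeleton_meet_def skeleton_def)
    then show False
      using skeleton_filter_improper[OF E xy] n x by simp
  qed
  with E show "is_prime_skeleton_filter L E"
    by (simp add: is_prime_skeleton_filter_def)
next
  assume P: "is_prime_skeleton_filter L E"
  then have E: "is_skeleton_filter L E"
    by (simp add: is_prime_skeleton_filter_def)
  have "x \<in> E \<or> \<Delta> x \<in> E" if x: "x \<in> skeleton L" for x
  proof -
    have c: "x \<in> carrier L"
      using x by (simp add: skeleton_def)
    \<comment> \<open>The join is \<open>\<top>\<close>, so primeness can be applied to the pair
      \<open>x\<close>, \<open>\<Delta> x\<close>.\<close>
    have "x \<squnion> \<Delta> x \<in> E"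
      using skeleton_filter_top[OF E] join_delta[OF c] by simp
    then show ?thesis
      using P x delta_in_skeleton[OF c] by (auto simp: is_prime_skeleton_filter_def)
  qed
  with E show "is_primary_skeleton_filter L E"
    by (simp add: is_primary_skeleton_filter_def)
qed

text \<open>A strictly larger filter \<open>H\<close> contains some \<open>x\<close> outside
  \<open>E\<close>; primariness puts \<open>\<Delta> x\<close> into \<open>E\<close>, hence into
  \<open>H\<close>, which makes \<open>H\<close> improper.\<close>

lemma primary_skeleton_filter_maximal:
  assumes P: "is_primary_skeleton_filter L E"
  shows "is_maximal_skeleton_filter L E"
proof -
  have False if H: "is_skeleton_filter L H" and EH: "E \<subset> H" and HS: "H \<subset> skeleton L" for H
  proof -
    obtain x where x: "x \<in> H" "x \<notin> E"
      using EH by auto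
    then have "\<Delta> x \<in> H"
      using P EH HS by (auto simp: is_primary_skeleton_filter_def)
    then show False
      using skeleton_filter_improper[OF H x(1)] HS by auto
  qed
  then show ?thesis
    using P by (auto simp: is_maximal_skeleton_filter_def is_primary_skeleton_filter_def)
qed

text \<open>This set is the filter generated by \<open>F\<close> and \<open>x\<close>, the extension
  against which maximality is tested.\<close>

lemma lattice_filter_adjoin:
  assumes F: "is_lattice_filter L F" and x: "x \<in> carrier L"
  shows "is_lattice_filter L {z \<in> carrier L. \<exists>f\<in>F. f \<sqinter> x \<sqsubseteq> z}" (is "is_lattice_filter L ?H")
proof -
  have Fc: "f \<in> carrier L" if "f \<in> F" for f
    using F that by (auto simp: is_lattice_filter_def)
  have "?H \<noteq> {}"
  proof -
    obtain f where "f \<in> F"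
      using F by (auto simp: is_lattice_filter_def)
    then have "x \<in> ?H"
      using x Fc meet_right by blast
    then show ?thesis by blast
  qed
  moreover have "z \<in> ?H" if "y \<in> ?H" "z \<in> carrier L" "y \<sqsubseteq> z" for y z
    using that Fc x by simp (meson le_trans meet_closed)
  moreover have "y \<sqinter> z \<in> ?H" if y: "y \<in> ?H" and z: "z \<in> ?H" for y z
  proof -
    obtain f g where f: "f \<in> F" "f \<sqinter> x \<sqsubseteq> y" and g: "g \<in> F" "g \<sqinter> x \<sqsubseteq> z"
      using y z by auto
    have c: "f \<in> carrier L" "g \<in> carrier L" "y \<in> carrier L" "z \<in> carrier L"
      using f g y z Fc by auto
    have le: "(f \<sqinter> g) \<sqinter> x \<sqsubseteq> f \<sqinter> g" "(f \<sqinter> g) \<sqinter> x \<sqsubseteq> x" "f \<sqinter> g \<sqsubseteq> f" "f \<sqinter> g \<sqsubseteq> g"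
      using c x meet_left meet_right by auto
    \<comment> \<open>The common witness for \<open>y \<sqinter> z\<close> is
      \<open>f \<sqinter> g\<close>.\<close>
    have "(f \<sqinter> g) \<sqinter> x \<sqsubseteq> f \<sqinter> x" "(f \<sqinter> g) \<sqinter> x \<sqsubseteq> g \<sqinter> x"
      using c x le by (auto intro!: meet_le intro: le_trans)
    then have "(f \<sqinter> g) \<sqinter> x \<sqsubseteq> y" "(f \<sqinter> g) \<sqinter> x \<sqsubseteq> z"
      using c x f(2) g(2) by (meson le_trans meet_closed)+
    then have "(f \<sqinter> g) \<sqinter> x \<sqsubseteq> y \<sqinter> z"
      using c x by (auto intro!: meet_le)
    moreover have "f \<sqinter> g \<in> F"
      using F f g by (simp add: is_lattice_filter_def)
    ultimately show ?thesis
      using c by auto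
  qed
  ultimately show ?thesis
    by (auto simp: is_lattice_filter_def)
qed

lemma maximal_filter_primary:
  assumes M: "is_maximal_filter L F"
  shows "is_primary_filter L F"
proof -
  have F: "is_lattice_filter L F"
    using M by (simp add: is_maximal_filter_def)
  have Fc: "f \<in> carrier L" if "f \<in> F" for f
    using F that by (auto simp: is_lattice_filter_def)
  have "\<Delta> x \<in> F" if x: "x \<in> carrier L" and nx: "x \<notin> F" for x
  proof -
    let ?H = "{z \<in> carrier L. \<exists>f\<in>F. f \<sqinter> x \<sqsubseteq> z}"
    obtain f0 where "f0 \<in> F"
      using F by (auto simp: is_lattice_filter_def)
    then have "x \<in> ?H"
      using x Fc meet_right by blast
    moreover have "F \<subseteq> ?H"
      using x Fc meet_left by blast
    \<comment> \<open>Strict because \<open>x\<close> lies in \<open>?H\<close> but not in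
      \<open>F\<close>; maximality then forces \<open>?H\<close> to be improper.\<close>
    ultimately have "F \<subset> ?H"
      using nx by blast
    then have "?H = carrier L"
      using M lattice_filter_adjoin[OF F x] unfolding is_maximal_filter_def by blast
    then have "\<bottom> \<in> ?H" by simp
    then obtain f where f: "f \<in> F" "f \<sqinter> x \<sqsubseteq> \<bottom>" by blast
    have fc: "f \<in> carrier L" and dc: "\<Delta> x \<in> carrier L"
      using f Fc x delta_closed by auto
    have "f \<sqinter> x = \<bottom>"
      using f fc x by (intro le_antisym) auto
    then have "f = \<bottom> \<squnion> (f \<sqinter> \<Delta> x)"
      using delta_decomp[OF fc x] by simp
    also have "\<dots> = f \<sqinter> \<Delta> x"
      using bottom_join[of "f \<sqinter> \<Delta> x"] fc dc by (simp add: eq_is_equal)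
    finally have "f \<sqsubseteq> \<Delta> x"
      using meet_right[OF fc dc] by metis
    then show ?thesis
      using F f dc by (auto simp: is_lattice_filter_def)
  qed
  with F show ?thesis
    by (auto simp: is_primary_filter_def)
qed

end

text \<open>The chain with \<open>n + 1\<close> elements under the trivial weak dicomplementation;
  the counterexample is the case \<open>n = 2\<close>.\<close>

definition chain_wdl :: "nat \<Rightarrow> nat wdl" where
  "chain_wdl n = \<lparr>carrier = {..n}, eq = (=), le = (\<le>),
     delta = (\<lambda>x. if x = n then 0 else n), nabla = (\<lambda>x. if x = 0 then n else 0)\<rparr>"

lemma chain_wdl_simps [simp]:
  "carrier (chain_wdl n) = {..n}"
  "x .=\<^bsub>chain_wdl n\<^esub> y \<longleftrightarrow> x = y"
  "x \<sqsubseteq>\<^bsub>chain_wdl n\<^esub> y \<longleftrightarrow> x \<le> y"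
  "\<Delta>\<^bsub>chain_wdl n\<^esub> x = (if x = n then 0 else n)"
  "\<nabla>\<^bsub>chain_wdl n\<^esub> x = (if x = 0 then n else 0)"
  by (simp_all add: chain_wdl_def)

interpretation chain_wdl: bounded_lattice "chain_wdl n" for n
proof
  fix x y assume "x \<in> carrier (chain_wdl n)" "y \<in> carrier (chain_wdl n)"
  then show "\<exists>s. least (chain_wdl n) s (Upper (chain_wdl n) {x, y})"
    and "\<exists>s. greatest (chain_wdl n) s (Lower (chain_wdl n) {x, y})"
    by (force simp: least_def Upper_def intro: exI[of _ "max x y"],
        force simp: greatest_def Lower_def intro: exI[of _ "min x y"])
next
  show "\<exists>x. least (chain_wdl n) x (carrier (chain_wdl n))"
    by (auto simp: least_def)
  show "\<exists>x. greatest (chain_wdl n) x (carrier (chain_wdl n))"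
    by (auto simp: greatest_def)
qed (auto simp: fun_eq_iff)

text \<open>The library join is a chosen least upper bound, so its value is recovered from the
  bounding inequalities and antisymmetry.\<close>

lemma chain_wdl_join:
  assumes "x \<le> n" "y \<le> n"
  shows "x \<squnion>\<^bsub>chain_wdl n\<^esub> y = max x y"
  using assms chain_wdl.join_left[where x=x and y=y and n=n] chain_wdl.join_right[where x=x and y=y and n=n]
    chain_wdl.join_le[where x=x and y=y and n=n and z="max x y"] by auto

lemma chain_wdl_meet:
  assumes "x \<le> n" "y \<le> n"
  shows "x \<sqinter>\<^bsub>chain_wdl n\<^esub> y = min x y"
  using assms chain_wdl.meet_left[where x=x and y=y and n=n] chain_wdl.meet_right[where x=x and y=y and n=n]
    chain_wdl.meet_le[where x=x and y=y and n=n and z="min x y"] by auto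

text \<open>For the decomposition law, one of \<open>y\<close> and \<open>\<Delta> y\<close> is the
  top \<open>n\<close>, so one of the two meets is already \<open>x\<close>; the law for
  \<open>\<nabla>\<close> is dual, with bottom \<open>0\<close>.\<close>

lemma weakly_dicomplemented_chain_wdl: "weakly_dicomplemented_lattice (chain_wdl n)"
  by unfold_locales (auto simp: chain_wdl_join chain_wdl_meet)

lemma lattice_filter_chain_wdl:
  assumes "k \<le> n"
  shows "is_lattice_filter (chain_wdl n) {k..n}"
  using assms by (auto simp: is_lattice_filter_def chain_wdl_meet)

lemma primary_filter_chain_wdl: "is_primary_filter (chain_wdl n) {n}"
  using lattice_filter_chain_wdl[of n n] by (auto simp: is_primary_filter_def)

lemma not_maximal_filter_chain_wdl:
  assumes "n \<ge> 2"
  shows "\<not> is_maximal_filter (chain_wdl n) {n}"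
proof -
  \<comment> \<open>The larger filter is \<open>{1..n}\<close>: the element \<open>1\<close> makes
    the inclusion strict, as \<open>n\<close> is at least 2, and \<open>0\<close> keeps it
    proper.\<close>
  have "1 \<in> {1..n} - {n}" "0 \<in> {..n} - {1..n}" "{n} \<subseteq> {1..n}"
    using assms by auto
  then have "{n} \<subset> {1..n}" "{1..n} \<noteq> {..n}"
    by blast+
  then show ?thesis
    using lattice_filter_chain_wdl[of 1 n] assms unfolding is_maximal_filter_def by auto
qed

theorem theorem5p3:
  fixes L :: "('a, 'b) wdl_scheme" and E F :: "'a set"
  assumes "weakly_dicomplemented_lattice L"
    and "is_skeleton_filter L E"
    and "is_lattice_filter L F"
  shows "(is_primary_skeleton_filter L E \<longleftrightarrow> is_prime_skeleton_filter L E)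
    \<and> (is_primary_skeleton_filter L E \<longrightarrow> is_maximal_skeleton_filter L E)
    \<and> (is_maximal_filter L F \<longrightarrow> is_primary_filter L F)
    \<and> (\<exists>(M :: nat wdl) G. weakly_dicomplemented_lattice M \<and> is_primary_filter M G
          \<and> G \<noteq> carrier M \<and> \<not> is_maximal_filter M G)"
proof -
  interpret weakly_dicomplemented_lattice L by fact
  \<comment> \<open>The element \<open>0\<close> shows that \<open>{2}\<close> is proper, so the
    counterexample does not fail maximality merely by being the whole lattice.\<close>
  have "0 \<in> carrier (chain_wdl 2) - {2}"
    by simp
  then have "\<exists>(M :: nat wdl) G. weakly_dicomplemented_lattice M \<and> is_primary_filter M G
      \<and> G \<noteq> carrier M \<and> \<not> is_maximal_filter M G"
    using weakly_dicomplemented_chain_wdl primary_filter_chain_wdl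
      not_maximal_filter_chain_wdl[of 2] by blast
  then show ?thesis
    using primary_iff_prime_skeleton_filter primary_skeleton_filter_maximal
      maximal_filter_primary by blast
qed

end
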